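(* For all $n\ge1$ and all $0\le k\le n$, $P_{0,k,2n+1}=P_{0,n-k,2n+1}$ and $P_{1,k,2n+1}=P_{1,n-k-1,2n+1}$ (where coefficients with negative index $k$ are $0$).
   Context: $\mathcal{S}_m$ denotes the set of permutations $\sigma=\sigma_1\cdots\sigma_m$ of $\{1,\dots,m\}$. $\overrightarrow{des}_E(\sigma)$ is the number of indices $i\in\{1,\dots,m-1\}$ with $\sigma_i>\sigma_{i+1}$ and $\sigma_{i+1}$ even. For $j\in\{0,1\}$, $P_{j,k,m}$ is the number of $\sigma\in\mathcal{S}_m$ with $\overrightarrow{des}_E(\sigma)=k$ such that $\sigma_1$ is even if $j=1$ and $\sigma_1$ is odd if $j=0$. *)

theory Defs
  imports "HOL-Combinatorics.Multiset_Permutations"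
begin

(* A permutation of {1..m} is its one-line word sigma_1 ... sigma_m, an element of
   permutations_of_set {1..m}; list positions start at 0, so sigma_i is \<sigma> ! (i - 1). *)

definition des_E :: "nat list \<Rightarrow> nat" where
  "des_E \<sigma> = card {i. Suc i < length \<sigma> \<and> \<sigma> ! i > \<sigma> ! Suc i \<and> even (\<sigma> ! Suc i)}"

(* The index k is an integer, so that P j k m = 0 for negative k. Only j = 0 and j = 1
   are meaningful. *)
definition P :: "nat \<Rightarrow> int \<Rightarrow> nat \<Rightarrow> nat" where
  "P j k m = card {\<sigma> \<in> permutations_of_set {1..m}. int (des_E \<sigma>) = k \<and>
     (j = 1 \<and> even (hd \<sigma>) \<or> j = 0 \<and> odd (hd \<sigma>))}"

end

theory Submission
  imports Defs
begin

text \<open>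
  The complement \<open>x \<mapsto> 2n + 2 - x\<close> of \<open>{1..2n+1}\<close> preserves parity and reverses the order.
  Each even letter other than the first letter of \<open>\<sigma>\<close> is therefore the bottom of a descent
  in exactly one of \<open>\<sigma>\<close> and its complement, and there are \<open>n\<close> or \<open>n - 1\<close> such letters,
  depending on the parity of the first letter.
\<close>

lemma card_even_letters: "card {x \<in> {1..2 * n + 1}. even x} = n"
proof -
  have "{x \<in> {1..2 * n + 1}. even x} = (*) 2 ` {1..n}"
    by (auto elim!: evenE)
  then show ?thesis
    by (simp add: card_image inj_on_def)
qed

lemma card_even_positions:
  assumes "distinct xs"
  shows "card {i. i < length xs \<and> even (xs ! i)} = card {x \<in> set xs. even (x :: nat)}"
proof (rule bij_betw_same_card)
  show "bij_betw ((!) xs) {i. i < length xs \<and> even (xs ! i)} {x \<in> set xs. even x}"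
    using assms by (auto simp: bij_betw_def inj_on_def nth_eq_iff_index_eq in_set_conv_nth)
qed

lemma des_E_complement:
  assumes "\<sigma> \<in> permutations_of_set {1..2 * n + 1}"
  shows "int (des_E \<sigma>) + int (des_E (map (\<lambda>x. 2 * n + 2 - x) \<sigma>))
    = int n - (if even (hd \<sigma>) then 1 else 0)"
proof -
  have set: "set \<sigma> = {1..2 * n + 1}" and dist: "distinct \<sigma>"
    using assms by (auto simp: permutations_of_set_def)
  then obtain a \<tau> where \<sigma>: "\<sigma> = a # \<tau>"
    by (cases \<sigma>) auto
  let ?D = "{i. Suc i < length \<sigma> \<and> \<sigma> ! i > \<sigma> ! Suc i \<and> even (\<sigma> ! Suc i)}"
  let ?A = "{i. Suc i < length \<sigma> \<and> \<sigma> ! i < \<sigma> ! Suc i \<and> even (\<sigma> ! Suc i)}"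
  \<comment> \<open>Within these bounds the truncated subtraction \<open>2 * n + 2 - x\<close> is
    the true one, so it reverses strict order and keeps parity.\<close>
  have bound: "1 \<le> \<sigma> ! i \<and> \<sigma> ! i \<le> 2 * n + 1" if "i < length \<sigma>" for i
    using nth_mem[OF that] set by auto
  have "Suc i < length (map (\<lambda>x. 2 * n + 2 - x) \<sigma>)
      \<and> map (\<lambda>x. 2 * n + 2 - x) \<sigma> ! i > map (\<lambda>x. 2 * n + 2 - x) \<sigma> ! Suc i
      \<and> even (map (\<lambda>x. 2 * n + 2 - x) \<sigma> ! Suc i)
    \<longleftrightarrow> Suc i < length \<sigma> \<and> \<sigma> ! i < \<sigma> ! Suc i \<and> even (\<sigma> ! Suc i)" for i
    using bound[of i] bound[of "Suc i"] by auto
  then have compl: "des_E (map (\<lambda>x. 2 * n + 2 - x) \<sigma>) = card ?A"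
    unfolding des_E_def by presburger
  have "\<sigma> ! i \<noteq> \<sigma> ! Suc i" if "Suc i < length \<sigma>" for i
    using dist that by (simp add: nth_eq_iff_index_eq)
  \<comment> \<open>Position \<open>Suc i\<close> of \<open>\<sigma>\<close> is position
    \<open>i\<close> of \<open>\<tau>\<close>. Adjacent letters differ, so every even letter of the
    tail ends either a descent or an ascent.\<close>
  then have un: "?D \<union> ?A = {i. i < length \<tau> \<and> even (\<tau> ! i)}"
    using \<sigma> by (auto simp: neq_iff)
  have "finite ?D" "finite ?A"
    by (auto intro: finite_subset[of _ "{..<length \<sigma>}"])
  then have "card ?D + card ?A = card (?D \<union> ?A)"
    by (subst card_Un_disjoint) auto
  also have "\<dots> = card {x \<in> set \<tau>. even x}"
    unfolding un using dist \<sigma> by (simp add: card_even_positions)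
  also have "{x \<in> set \<tau>. even x} = {x \<in> {1..2 * n + 1}. even x} - {a}"
    unfolding set[symmetric] using dist by (auto simp: \<sigma>)
  finally have eq: "card ?D + card ?A = card ({x \<in> {1..2 * n + 1}. even x} - {a})" .
  have a: "a \<in> {1..2 * n + 1}"
    unfolding set[symmetric] by (simp add: \<sigma>)
  show ?thesis
  proof (cases "even a")
    case True
    \<comment> \<open>An even letter \<open>a\<close> in the range forces \<open>n \<ge> 1\<close>,
      so the natural number \<open>n - 1\<close> agrees with the integer difference in the
      goal.\<close>
    then have "card ?D + card ?A = n - 1" "n \<ge> 1"
      using eq a card_even_letters[of n] by (auto simp: card_Diff_singleton elim!: evenE)
    then show ?thesis
      unfolding compl des_E_def[of \<sigma>] using True \<sigma> by simp
  next
    case False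
    then have "card ?D + card ?A = n"
      using eq card_even_letters[of n] by simp
    then show ?thesis
      unfolding compl des_E_def[of \<sigma>] using False \<sigma> by simp
  qed
qed

text \<open>Together the three parts make the complement an involution on the words whose first
  letter has a prescribed parity.\<close>

lemma complement_permutation:
  fixes n :: nat
  assumes "\<sigma> \<in> permutations_of_set {1..2 * n + 1}"
  shows "map (\<lambda>x. 2 * n + 2 - x) \<sigma> \<in> permutations_of_set {1..2 * n + 1}"
    and "map (\<lambda>x. 2 * n + 2 - x) (map (\<lambda>x. 2 * n + 2 - x) \<sigma>) = \<sigma>"
    and "even (hd (map (\<lambda>x. 2 * n + 2 - x) \<sigma>)) \<longleftrightarrow> even (hd \<sigma>)"
proof -
  have set: "set \<sigma> = {1..2 * n + 1}" and dist: "distinct \<sigma>"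
    using assms by (auto simp: permutations_of_set_def)
  have "(\<lambda>x. 2 * n + 2 - x) ` {1..2 * n + 1} = {1..2 * n + 1}"
  proof (intro equalityI subsetI)
    fix y assume "y \<in> {1..2 * n + 1}"
    then show "y \<in> (\<lambda>x. 2 * n + 2 - x) ` {1..2 * n + 1}"
      \<comment> \<open>The complement is its own inverse, so the preimage of \<open>y\<close> is
        its complement.\<close>
      by (intro image_eqI[of _ _ "2 * n + 2 - y"]) auto
  qed auto
  then show "map (\<lambda>x. 2 * n + 2 - x) \<sigma> \<in> permutations_of_set {1..2 * n + 1}"
    using set dist by (auto simp: permutations_of_set_def distinct_map inj_on_def)
  show "map (\<lambda>x. 2 * n + 2 - x) (map (\<lambda>x. 2 * n + 2 - x) \<sigma>) = \<sigma>"
    using set by (auto intro!: map_idI)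
  have "\<sigma> \<noteq> []"
    using set by auto
  moreover from this have "hd \<sigma> \<in> {1..2 * n + 1}"
    using set hd_in_set by metis
  ultimately show "even (hd (map (\<lambda>x. 2 * n + 2 - x) \<sigma>)) \<longleftrightarrow> even (hd \<sigma>)"
    by (auto simp: hd_map)
qed

text \<open>Treats both parities at once: when the first letter has the parity encoded by
  \<open>j\<close>, the correction term in \<open>des_E_complement\<close> equals \<open>j\<close>.
  For any other \<open>j\<close> both sets are empty.\<close>

lemma P_complement:
  "P j k (2 * n + 1) = P j (int n - int j - k) (2 * n + 1)"
proof -
  let ?f = "map (\<lambda>x. 2 * n + 2 - x)"
  let ?S = "\<lambda>k. {\<sigma> \<in> permutations_of_set {1..2 * n + 1}. int (des_E \<sigma>) = k \<and>
     (j = 1 \<and> even (hd \<sigma>) \<or> j = 0 \<and> odd (hd \<sigma>))}"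
  have maps: "?f \<sigma> \<in> ?S (int n - int j - k)" if "\<sigma> \<in> ?S k" for \<sigma> k
    using that complement_permutation[of \<sigma> n] des_E_complement[of \<sigma> n]
    by (auto simp del: map_map)
  \<comment> \<open>The index map \<open>k \<mapsto> n - j - k\<close> is an involution on the
    integers, so \<open>maps\<close> at the reflected index leads back to \<open>k\<close>.\<close>
  have maps': "?f \<sigma> \<in> ?S k" if "\<sigma> \<in> ?S (int n - int j - k)" for \<sigma>
    using maps[OF that] by simp
  have inv: "?f (?f \<sigma>) = \<sigma>" if "\<sigma> \<in> ?S l" for \<sigma> l
    using that complement_permutation(2)[of \<sigma> n] by simp
  have "bij_betw ?f (?S k) (?S (int n - int j - k))"
    by (rule bij_betw_byWitness[where f' = ?f])
      (intro ballI inv image_subsetI maps maps'; assumption)+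
  then show ?thesis
    unfolding P_def by (rule bij_betw_same_card)
qed

theorem theorem4p4:
  fixes n k :: nat
  assumes "n \<ge> 1" and "k \<le> n"
  shows "P 0 (int k) (2 * n + 1) = P 0 (int n - int k) (2 * n + 1)
    \<and> P 1 (int k) (2 * n + 1) = P 1 (int n - int k - 1) (2 * n + 1)"
  \<comment> \<open>For \<open>k = n\<close> the second equation has index -1 on the right; the
    integer-indexed lemma covers this case too.\<close>
  using P_complement[of 0 "int k" n] P_complement[of 1 "int k" n]
  by (simp add: algebra_simps)

end
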